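(* If a spherical random field $T(\mathbf{x})$, $\mathbf{x}\in\mathbb{S}^2$, is isotropic at every point of $\mathbb{S}^2$, then it is (globally) isotropic.
   Context: $\mathbb{S}^2$ is the unit sphere in $\mathbb{R}^3$ and $\gamma$ is the great-circle (angular) distance. Standing assumptions: a spherical random field is a real-valued second-order random field $T$ on $\mathbb{S}^2$ with zero mean whose covariance function $C(\mathbf{x}_1,\mathbf{x}_2)=\mathbf{E}(T(\mathbf{x}_1)T(\mathbf{x}_2))$ is continuous on $\mathbb{S}^2\times\mathbb{S}^2$ and not identically constant. The field is (globally) isotropic if $C(\rho\mathbf{x}_1,\rho\mathbf{x}_2)=C(\mathbf{x}_1,\mathbf{x}_2)$ for all $\rho\in SO(3)$ and all $\mathbf{x}_1,\mathbf{x}_2$; equivalently $C(\mathbf{x}_1,\mathbf{x}_2)=B(\gamma(\mathbf{x}_1,\mathbf{x}_2))$ for a single function $B:[0,\pi]\to\mathbb{R}$. The field is isotropic at a point $\mathbf{x}_0$ if there is a function $B_{\mathbf{x}_0}:[0,\pi]\to\mathbb{R}$ (possibly depending on $\mathbf{x}_0$) with $C(\mathbf{x}_0,\mathbf{x})=B_{\mathbf{x}_0}(\gamma(\mathbf{x}_0,\mathbf{x}))$ for all $\mathbf{x}\in\mathbb{S}^2$. *)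

theory Defs
  imports "HOL-Probability.Probability"
begin

text \<open>
  A field on the sphere is a family \<open>T\<close> indexed by \<^typ>\<open>real^3\<close> of which only the members with
  index in the unit sphere are ever constrained or used.
\<close>

abbreviation S2 :: "(real^3) set" where
  "S2 \<equiv> sphere 0 1"

text \<open>For unit vectors this is the great-circle distance, with values in \<open>[0, \<pi>]\<close>.\<close>

definition angular_dist :: "real^3 \<Rightarrow> real^3 \<Rightarrow> real" where
  "angular_dist x y = arccos (x \<bullet> y)"

text \<open>Uncentred product moment; it is the covariance because the fields below have zero mean.\<close>

definition covariance_fun ::
  "'w measure \<Rightarrow> (real^3 \<Rightarrow> 'w \<Rightarrow> real) \<Rightarrow> real^3 \<Rightarrow> real^3 \<Rightarrow> real" where
  "covariance_fun M T x y = (LINT \<omega>|M. T x \<omega> * T y \<omega>)"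

locale spherical_random_field = prob_space M
  for M :: "'w measure" +
  fixes T :: "real^3 \<Rightarrow> 'w \<Rightarrow> real"
  assumes random_variable: "x \<in> S2 \<Longrightarrow> random_variable borel (T x)"
    and second_order: "x \<in> S2 \<Longrightarrow> integrable M (\<lambda>\<omega>. (T x \<omega>)\<^sup>2)"
    and zero_mean: "x \<in> S2 \<Longrightarrow> expectation (T x) = 0"
    and continuous_covariance:
      "continuous_on (S2 \<times> S2) (\<lambda>(x, y). covariance_fun M T x y)"
    and nonconstant_covariance:
      "\<not> (\<lambda>(x, y). covariance_fun M T x y) constant_on (S2 \<times> S2)"

definition isotropic :: "'w measure \<Rightarrow> (real^3 \<Rightarrow> 'w \<Rightarrow> real) \<Rightarrow> bool" where
  "isotropic M T \<longleftrightarrow>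
    (\<forall>\<rho> :: real^3^3. rotation_matrix \<rho> \<longrightarrow>
      (\<forall>x\<in>S2. \<forall>y\<in>S2. covariance_fun M T (\<rho> *v x) (\<rho> *v y) = covariance_fun M T x y))"

text \<open>Values of \<open>B\<close> outside \<open>[0, \<pi>]\<close> are irrelevant, by the range of \<^const>\<open>angular_dist\<close>.\<close>

definition isotropic_at :: "'w measure \<Rightarrow> (real^3 \<Rightarrow> 'w \<Rightarrow> real) \<Rightarrow> real^3 \<Rightarrow> bool" where
  "isotropic_at M T x0 \<longleftrightarrow>
    (\<exists>B :: real \<Rightarrow> real. \<forall>x\<in>S2. covariance_fun M T x0 x = B (angular_dist x0 x))"

end

theory Submission
  imports Defs
begin

text \<open>
  Symmetry of the covariance gives \<open>B\<^sub>x(\<theta>) = B\<^sub>y(\<theta>)\<close> whenever \<open>x\<close> and \<open>y\<close> are at distance \<open>\<theta>\<close>.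
  For \<open>0 < \<theta> < \<pi>\<close> any two sufficiently close points have a common neighbour at distance \<open>\<theta>\<close>, so
  \<open>x \<mapsto> B\<^sub>x(\<theta>)\<close> is locally constant, hence constant as the sphere is connected. The remaining
  distances \<open>0\<close> and \<open>\<pi>\<close> are reached by continuity.
\<close>

text \<open>The circles of points having inner product \<open>t\<close> with \<open>x\<close> and
  with \<open>z\<close> cross when the angle between the centres is below twice arccos
  \<open>\<bar>t\<bar>\<close>. Since cos (2 arccos \<open>\<bar>t\<bar>\<close>) =
  \<open>2 * t\<^sup>2 - 1\<close>, this is the bound \<open>close\<close>.\<close>

lemma unit_vector_common_inner:
  fixes x z :: "real^3"
  assumes x: "norm x = 1" and z: "norm z = 1" and "x \<noteq> z"
    and t: "\<bar>t\<bar> < 1" and close: "2 * t\<^sup>2 - 1 < x \<bullet> z"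
  obtains y where "norm y = 1" "x \<bullet> y = t" "z \<bullet> y = t"
proof -
  define s where "s = x \<bullet> z"
  have xx: "x \<bullet> x = 1" "z \<bullet> z = 1"
    using x z by (simp_all add: norm_eq_1)
  have "(x - z) \<bullet> (x - z) > 0"
    using \<open>x \<noteq> z\<close> by simp
  then have s1: "s < 1"
    by (simp add: inner_diff inner_commute xx s_def)
  have s2: "2 * t\<^sup>2 < 1 + s" 
    using close by (simp add: s_def)
  then have s3: "0 < 1 + s"
    using zero_le_power2[of t] by linarith
  \<comment> \<open>By symmetry \<open>y\<close> is sought as
    \<open>a *\<^sub>R (x + z) + b *\<^sub>R u\<close>. As \<open>u\<close> is orthogonal to
    \<open>x\<close> and \<open>z\<close>, both inner products equal \<open>a * (1 + s)\<close>,
    which fixes \<open>a\<close>. Then \<open>b\<close> makes up the missing length: the first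
    summand has squared norm \<open>2 * t\<^sup>2 / (1 + s)\<close>, and \<open>u\<close> has
    \<open>1 - s\<^sup>2\<close>.\<close>
  define a where "a = t / (1 + s)"
  define b where "b = sqrt ((1 - 2 * t\<^sup>2 / (1 + s)) / (1 - s\<^sup>2))"
  define u where "u = cross3 x z"
  have pos: "0 < 1 - s\<^sup>2"
    using mult_pos_pos[OF s3, of "1 - s"] s1 by (simp add: algebra_simps power2_eq_square)
  have "0 \<le> (1 - 2 * t\<^sup>2 / (1 + s)) / (1 - s\<^sup>2)"
    using s2 s3 pos by (intro divide_nonneg_pos) simp_all
  then have b2: "b\<^sup>2 * (1 - s\<^sup>2) = 1 - 2 * t\<^sup>2 / (1 + s)"
    using pos by (simp add: b_def)
  have uu: "u \<bullet> u = 1 - s\<^sup>2"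
    using norm_cross_dot[of x z] x z by (simp add: u_def s_def power2_norm_eq_inner)
  have xu: "x \<bullet> u = 0" "z \<bullet> u = 0"
    by (simp_all add: u_def dot_cross_self)
  define y where "y = a *\<^sub>R (x + z) + b *\<^sub>R u"
  have as: "a * (1 + s) = t"
    using s3 by (simp add: a_def)
  have "x \<bullet> y = t" "z \<bullet> y = t"
    using as by (simp_all add: y_def inner_add_right xx xu inner_commute[of z x] algebra_simps
        flip: s_def)
  moreover have "y \<bullet> y = 1"
  proof -
    have uy: "u \<bullet> y = b * (1 - s\<^sup>2)"
      using xu by (simp add: y_def inner_add_right inner_commute uu)
    have "y \<bullet> y = a * (x \<bullet> y) + a * (z \<bullet> y) + b * (u \<bullet> y)"
      by (subst (1) y_def) (simp add: inner_add_left algebra_simps)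
    also have "\<dots> = 2 * a * t + b\<^sup>2 * (1 - s\<^sup>2)"
      by (simp add: \<open>x \<bullet> y = t\<close> \<open>z \<bullet> y = t\<close> uy power2_eq_square)
    finally show ?thesis
      by (simp add: b2) (simp add: a_def power2_eq_square)
  qed
  ultimately show ?thesis
    using that by (auto simp: norm_eq_1)
qed

lemma connected_S2: "connected S2"
  by (rule connected_sphere) simp

text \<open>Profiles take the inner product, that is the cosine of the distance, as argument, so the
  geometry is free of arccos and of probability.\<close>

locale pointwise_isotropic_kernel =
  fixes C :: "real^3 \<Rightarrow> real^3 \<Rightarrow> real" and B :: "real^3 \<Rightarrow> real \<Rightarrow> real"
  assumes sym: "C x y = C y x"
    and kernel: "\<lbrakk>norm x = 1; norm y = 1\<rbrakk> \<Longrightarrow> C x y = B x (x \<bullet> y)"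
begin

lemma profile_locally_constant:
  assumes "norm x = 1" "norm z = 1" "\<bar>t\<bar> < 1" "2 * t\<^sup>2 - 1 < x \<bullet> z"
  shows "B x t = B z t"
proof (cases "x = z")
  case False
  then obtain y where "norm y = 1" "x \<bullet> y = t" "z \<bullet> y = t"
    using unit_vector_common_inner assms by blast
  then show ?thesis
    using kernel sym assms by (metis inner_commute)
qed simp

lemma profile_constant:
  assumes "norm x = 1" "norm z = 1" and t: "\<bar>t\<bar> < 1"
  shows "B x t = B z t"
proof (rule connected_local_const[OF connected_S2, where f = "\<lambda>x. B x t"])
  have "eventually (\<lambda>z. B x t = B z t) (at x within S2)" if "norm x = 1" for x
  proof -
    \<comment> \<open>The closeness bound is strict at \<open>z = x\<close>, so continuity of the
      inner product carries it to all nearby \<open>z\<close>.\<close>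
    have "2 * t\<^sup>2 - 1 < x \<bullet> x"
      using that t by (simp add: norm_eq_1 abs_square_less_1)
    then have "eventually (\<lambda>z. 2 * t\<^sup>2 - 1 < x \<bullet> z) (at x within S2)"
      by (intro order_tendstoD(1)[where y = "x \<bullet> x"] tendsto_intros)
    then show ?thesis
      unfolding eventually_at_filter
      by eventually_elim (auto intro: profile_locally_constant that t)
  qed
  then show "\<forall>x\<in>S2. eventually (\<lambda>z. B x t = B z t) (at x within S2)"
    by simp
qed (use assms in auto)

text \<open>For fixed \<open>x\<close>, the set \<open>D\<close> of good \<open>y\<close> is closed
  by continuity and misses at most \<open>x\<close> and \<open>-x\<close>. Its complement is thus
  open and finite, hence clopen in a connected infinite sphere, and so empty.\<close>

lemma orthogonal_invariant:
  assumes cont: "continuous_on (S2 \<times> S2) (\<lambda>(x, y). C x y)"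
    and f: "orthogonal_transformation f"
    and x: "x \<in> S2" and y: "y \<in> S2"
  shows "C (f x) (f y) = C x y"
proof -
  define D where "D = {y \<in> S2. C (f x) (f y) - C x y = 0}"
  have fS: "f w \<in> S2" if "w \<in> S2" for w
    using that f by (simp add: orthogonal_transformation_norm)
  have cf: "continuous_on S2 f"
    using f by (simp add: linear_continuous_on orthogonal_transformation_linear linear_linear)
  have "continuous_on S2 (\<lambda>y. (\<lambda>(x, y). C x y) (f x, f y))"
    "continuous_on S2 (\<lambda>y. (\<lambda>(x, y). C x y) (x, y))"
    by (rule continuous_on_compose2[OF cont]; use x fS cf in \<open>auto intro!: continuous_intros\<close>)+
  then have "closedin (top_of_set S2) D"
    unfolding D_def
    by (intro continuous_closedin_preimage_constant continuous_intros) auto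
  then have "openin (top_of_set S2) (S2 - D)"
    by (simp add: openin_diff)
  moreover have sub: "S2 - D \<subseteq> {x, -x}"
  proof
    fix y assume "y \<in> S2 - D"
    then have y: "norm y = 1" "C (f x) (f y) \<noteq> C x y"
      by (auto simp: D_def)
    moreover have "f x \<bullet> f y = x \<bullet> y"
      using f by (simp add: orthogonal_transformation_def)
    \<comment> \<open>Otherwise both covariances would be values at the same
      \<open>x \<bullet> y\<close> of the profiles at \<open>f x\<close> and \<open>x\<close>, which
      agree there. What remains is equality in Cauchy-Schwarz.\<close>
    ultimately have "\<not> \<bar>x \<bullet> y\<bar> < 1"
      using x y fS kernel profile_constant by (metis mem_sphere_0)
    then have "\<bar>x \<bullet> y\<bar> = norm x * norm y"
      using Cauchy_Schwarz_ineq2[of x y] x y by simp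
    then show "y \<in> {x, -x}"
      using x y unfolding norm_cauchy_schwarz_abs_eq by (auto simp: minus_equation_iff)
  qed
  then have "closedin (top_of_set S2) (S2 - D)"
    by (intro closed_subset finite_imp_closed) (auto intro: finite_subset)
  ultimately have "S2 - D = {} \<or> S2 - D = S2"
    using connected_S2 unfolding connected_clopen by blast
  moreover have "x \<noteq> 0"
    using x by auto
  then have "x \<noteq> - x"
    by (simp add: vec_eq_iff)
  \<comment> \<open>A connected set with two distinct points is uncountable; this excludes
    \<open>S2 - D = S2\<close>.\<close>
  then have "infinite S2"
    using connected_uncountable[OF connected_S2, of x "- x"] x
    by (auto dest: countable_finite)
  ultimately show ?thesis
    using y sub finite_subset[of S2 "{x, -x}"] by (auto simp: D_def)
qed

end

theorem theorem2:
  fixes M :: "'w measure" and T :: "real^3 \<Rightarrow> 'w \<Rightarrow> real"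
  assumes "spherical_random_field M T"
    and "\<And>x0. x0 \<in> S2 \<Longrightarrow> isotropic_at M T x0"
  shows "isotropic M T"
proof -
  interpret spherical_random_field M T by fact
  obtain B where B: "covariance_fun M T x y = B x (angular_dist x y)"
    if "x \<in> S2" "y \<in> S2" for x y
    using assms(2) unfolding isotropic_at_def by metis
  \<comment> \<open>Composing with \<open>arccos\<close> turns a profile in the angle into one in
    the inner product; symmetry is commutativity of the product under the integral.\<close>
  interpret pointwise_isotropic_kernel "covariance_fun M T" "\<lambda>x t. B x (arccos t)"
    by unfold_locales (simp_all add: covariance_fun_def[of M T] mult.commute B[unfolded angular_dist_def covariance_fun_def])
  have "orthogonal_transformation ((*v) \<rho>)" if "rotation_matrix \<rho>" for \<rho> :: "real^3^3"
    using that by (simp add: rotation_matrix_def orthogonal_transformation_matrix)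
  then show ?thesis
    unfolding isotropic_def by (blast intro: orthogonal_invariant continuous_covariance)
qed

end
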